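(* Let $N=5$ and let $T=\{(s_1,s_2)\in\mathbb{R}^2: 0\leq s_1\leq 5,\ 2s_1\leq s_2\leq 10\}$. For every pure $5$-qubit state, the sector lengths satisfy $(S_1,S_2)\in T$ and $$S_3=10+2S_1-S_2,\qquad S_4=15-S_2,\qquad S_5=6-3S_1+S_2.$$ Moreover, for every point $(s_1,s_2)$ on the boundary of the triangle $T$ there exists a pure $5$-qubit state with $(S_1,S_2)=(s_1,s_2)$.
   Context: Let $\sigma_0$ be the $2\times 2$ identity and $\sigma_1,\sigma_2,\sigma_3$ the Pauli matrices. For $\boldsymbol{\mu}=(\mu_1,\dots,\mu_N)\in\{0,1,2,3\}^N$ put $\sigma_{\boldsymbol{\mu}}=\sigma_{\mu_1}\otimes\dots\otimes\sigma_{\mu_N}$, and let its weight $\mathrm{wt}(\sigma_{\boldsymbol{\mu}})$ be the number of nonzero entries of $\boldsymbol{\mu}$. For an $N$-qubit state (density matrix) $\rho$ on $(\mathbb{C}^2)^{\otimes N}$, the sector length is $S_m=S_m(\rho)=\sum_{\mathrm{wt}(\sigma_{\boldsymbol{\mu}})=m}\mathrm{Tr}(\rho\,\sigma_{\boldsymbol{\mu}})^2$. For a pure state $|\psi\rangle$ (a unit vector in $(\mathbb{C}^2)^{\otimes N}$), $S_m$ is evaluated at $\rho=|\psi\rangle\langle\psi|$. *)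

theory Defs
  imports "Jordan_Normal_Form.Matrix" "HOL-Analysis.Elementary_Topology"
begin

definition mat_trace :: "'a::comm_monoid_add mat \<Rightarrow> 'a" where
  "mat_trace A = (\<Sum>i<dim_row A. A $$ (i, i))"

definition kronecker :: "'a::times mat \<Rightarrow> 'a mat \<Rightarrow> 'a mat" where
  "kronecker A B =
     mat (dim_row A * dim_row B) (dim_col A * dim_col B)
       (\<lambda>(i, j). A $$ (i div dim_row B, j div dim_col B)
               * B $$ (i mod dim_row B, j mod dim_col B))"

(* Only the indices 0, 1, 2, 3 are meaningful. *)
definition pauli :: "nat \<Rightarrow> complex mat" where
  "pauli k = mat_of_rows_list 2
     (if k = 0 then [[1, 0], [0, 1]]
      else if k = 1 then [[0, 1], [1, 0]]
      else if k = 2 then [[0, - \<i>], [\<i>, 0]]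
      else [[1, 0], [0, - 1]])"

primrec pauli_string :: "nat list \<Rightarrow> complex mat" where
  "pauli_string [] = 1\<^sub>m 1"
| "pauli_string (k # ks) = kronecker (pauli k) (pauli_string ks)"

definition weight :: "nat list \<Rightarrow> nat" where
  "weight \<mu> = length (filter (\<lambda>k. k \<noteq> 0) \<mu>)"

(* The real part makes the sector length a real number. It discards nothing when
   \<rho> is Hermitian, as every density matrix is: see sector_length_hermitian. *)
definition sector_length :: "nat \<Rightarrow> nat \<Rightarrow> complex mat \<Rightarrow> real" where
  "sector_length N m \<rho> =
     (\<Sum>\<mu> \<in> {\<mu>. length \<mu> = N \<and> set \<mu> \<subseteq> {0, 1, 2, 3} \<and> weight \<mu> = m}.
        (Re (mat_trace (\<rho> * pauli_string \<mu>)))\<^sup>2)"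

definition pure_state :: "nat \<Rightarrow> complex vec \<Rightarrow> bool" where
  "pure_state N \<psi> \<longleftrightarrow> \<psi> \<in> carrier_vec (2 ^ N) \<and> \<psi> \<bullet>c \<psi> = 1"

definition projector :: "complex vec \<Rightarrow> complex mat" where
  "projector \<psi> = mat (dim_vec \<psi>) (dim_vec \<psi>) (\<lambda>(i, j). \<psi> $ i * cnj (\<psi> $ j))"

definition hermitian :: "complex mat \<Rightarrow> bool" where
  "hermitian A \<longleftrightarrow> dim_row A = dim_col A
     \<and> (\<forall>i < dim_row A. \<forall>j < dim_col A. A $$ (i, j) = cnj (A $$ (j, i)))"

lemma hermitianI:
  assumes "dim_row A = n" "dim_col A = n"
    and "\<And>i j. i < n \<Longrightarrow> j < n \<Longrightarrow> A $$ (i, j) = cnj (A $$ (j, i))"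
  shows "hermitian A"
  unfolding hermitian_def assms(1,2) by (intro conjI refl allI impI assms(3))

lemma hermitian_cnj:
  assumes "hermitian A" "i < dim_row A" "j < dim_row A"
  shows "cnj (A $$ (i, j)) = A $$ (j, i)"
proof -
  have "dim_row A = dim_col A"
    and *: "\<forall>i < dim_row A. \<forall>j < dim_col A. A $$ (i, j) = cnj (A $$ (j, i))"
    using assms(1) unfolding hermitian_def by (rule conjunct1, rule conjunct2)
  then have "j < dim_row A" "i < dim_col A"
    using assms(2,3) by simp_all
  then show ?thesis
    by (rule * [rule_format, symmetric])
qed

lemma hermitian_square: "hermitian A \<Longrightarrow> dim_col A = dim_row A"
  unfolding hermitian_def by (elim conjE) (rule sym)

lemma hermitian_kronecker:
  assumes A: "hermitian A" and B: "hermitian B"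
  shows "hermitian (kronecker A B)"
proof (rule hermitianI)
  note d = hermitian_square[OF A] hermitian_square[OF B]
  show "dim_row (kronecker A B) = dim_row A * dim_row B"
    by (simp add: kronecker_def)
  show "dim_col (kronecker A B) = dim_row A * dim_row B"
    by (simp add: kronecker_def d)
  fix i j
  assume ij: "i < dim_row A * dim_row B" "j < dim_row A * dim_row B"
  have pos: "dim_row B > 0"
    by (rule gr0I) (use ij(1) in simp)
  have q: "i div dim_row B < dim_row A" "j div dim_row B < dim_row A"
    by (rule less_mult_imp_div_less[OF ij(1)], rule less_mult_imp_div_less[OF ij(2)])
  have r: "i mod dim_row B < dim_row B" "j mod dim_row B < dim_row B"
    by (rule mod_less_divisor[OF pos])+
  have entry: "kronecker A B $$ (k, l) = A $$ (k div dim_row B, l div dim_row B)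
      * B $$ (k mod dim_row B, l mod dim_row B)"
    if "k < dim_row A * dim_row B" "l < dim_row A * dim_row B" for k l
    unfolding kronecker_def d by (subst index_mat(1)[OF that]) (simp only: prod.case)
  show "kronecker A B $$ (i, j) = cnj (kronecker A B $$ (j, i))"
    unfolding entry[OF ij] entry[OF ij(2) ij(1)] complex_cnj_mult
      hermitian_cnj[OF A q(2) q(1)] hermitian_cnj[OF B r(2) r(1)] ..
qed

lemma hermitian_pauli: "hermitian (pauli k)"
proof (rule hermitianI)
  show "dim_row (pauli k) = 2" "dim_col (pauli k) = 2"
    by (simp_all add: pauli_def mat_of_rows_list_def)
  fix i j :: nat
  assume "i < 2" "j < 2"
  then have "i = 0 \<or> i = 1" "j = 0 \<or> j = 1" by auto
  then show "pauli k $$ (i, j) = cnj (pauli k $$ (j, i))"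
    by (elim disjE) (simp_all add: pauli_def mat_of_rows_list_def)
qed

lemma hermitian_pauli_string: "hermitian (pauli_string \<mu>)"
proof (induction \<mu>)
  case Nil
  show ?case by (simp add: hermitian_def)
next
  case (Cons k ks)
  then show ?case using hermitian_kronecker hermitian_pauli by simp
qed

lemma dim_pauli_string:
  "dim_row (pauli_string \<mu>) = 2 ^ length \<mu>" "dim_col (pauli_string \<mu>) = 2 ^ length \<mu>"
  by (induction \<mu>) (auto simp: kronecker_def pauli_def mat_of_rows_list_def)

lemma hermitian_projector: "hermitian (projector \<psi>)"
  by (rule hermitianI[of _ "dim_vec \<psi>"]) (simp_all add: projector_def mult.commute)

lemma trace_hermitian_real:
  assumes "hermitian A" "hermitian B" "dim_row A = dim_row B"
  shows "mat_trace (A * B) \<in> \<real>"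
proof -
  define n where "n = dim_row A"
  have d: "dim_row A = n" "dim_col A = n" "dim_row B = n" "dim_col B = n"
    using assms(3) hermitian_square[OF assms(1)] hermitian_square[OF assms(2)]
    by (simp_all add: n_def)
  have A: "cnj (A $$ (i, j)) = A $$ (j, i)" if "i < n" "j < n" for i j
    using hermitian_cnj[OF assms(1), of i j] that d by simp
  have B: "cnj (B $$ (i, j)) = B $$ (j, i)" if "i < n" "j < n" for i j
    using hermitian_cnj[OF assms(2), of i j] that d by simp
  have t: "mat_trace (A * B) = (\<Sum>i<n. \<Sum>j<n. A $$ (i, j) * B $$ (j, i))"
    unfolding mat_trace_def
    by (simp add: d scalar_prod_def atLeast0LessThan)
  have "cnj (mat_trace (A * B)) = (\<Sum>i<n. \<Sum>j<n. A $$ (j, i) * B $$ (i, j))"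
    unfolding t by (simp add: A B)
  also have "\<dots> = mat_trace (A * B)"
    unfolding t by (rule sum.swap)
  finally show ?thesis
    by (rule iffD2[OF Reals_cnj_iff])
qed

lemma sector_length_hermitian:
  assumes "hermitian \<rho>" "\<rho> \<in> carrier_mat (2 ^ N) (2 ^ N)"
  shows "complex_of_real (sector_length N m \<rho>) =
    (\<Sum>\<mu> \<in> {\<mu>. length \<mu> = N \<and> set \<mu> \<subseteq> {0, 1, 2, 3} \<and> weight \<mu> = m}.
       (mat_trace (\<rho> * pauli_string \<mu>))\<^sup>2)"
proof -
  have "complex_of_real (Re (mat_trace (\<rho> * pauli_string \<mu>))) = mat_trace (\<rho> * pauli_string \<mu>)"
    if "length \<mu> = N" for \<mu>
    using trace_hermitian_real[OF assms(1) hermitian_pauli_string[of \<mu>]] assms(2) that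
    by (simp add: dim_pauli_string)
  then show ?thesis
    unfolding sector_length_def of_real_sum of_real_power
    by (intro sum.cong) auto
qed

end

theory Submission
  imports Defs "HOL-Analysis.L2_Norm"
begin

text \<open>
  Since \<open>\<Sum>\<^sub>k \<sigma>\<^sub>k \<otimes> \<sigma>\<^sub>k = 2 F\<close> with \<open>F\<close> the swap, the weight enumerator
  \<open>\<Sum>\<^sub>m \<alpha>\<^sup>N\<^sup>-\<^sup>m \<beta>\<^sup>m S\<^sub>m\<close> of a pure state is the expectation of \<open>((\<alpha> - \<beta>) 1 + 2 \<beta> F)\<^sup>\<otimes>\<^sup>N\<close> in two
  copies of the state. Swapping the two copies as a whole changes nothing, which gives the quantum
  MacWilliams identity and hence the three linear relations. For \<open>\<beta> \<le> 0 \<le> \<alpha> + \<beta>\<close> the operator is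
  positive; near \<open>(\<alpha>, \<beta>) = (1, -1)\<close> this is \<open>2 S\<^sub>1 \<le> S\<^sub>2\<close>. A pure three-qubit state has \<open>S\<^sub>2 = 3\<close>,
  so by convexity every three-qubit marginal has \<open>S\<^sub>2 \<le> 3\<close>, and averaging over the ten marginals gives
  \<open>S\<^sub>2 \<le> 10\<close>.

  The edge \<open>S\<^sub>2 = 10\<close> is attained by the states \<open>a |00000\<rangle> + b |11111\<rangle>\<close>. Write a superposition of
  even-weight strings by its amplitudes at weight 0, at two adjacent ones, at two nonadjacent ones
  (cyclically), and at weight 4. Then \<open>(1, -t, t, -t\<^sup>2)\<close> traces the edge \<open>S\<^sub>2 = 2 S\<^sub>1\<close> from a product
  state to the five-qubit code, and \<open>(1, w, 1, w)\<close> with \<open>|w| = 1\<close> traces \<open>S\<^sub>1 = 0\<close> from the code to a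
  GHZ state.
\<close>

section \<open>Pauli strings as sesquilinear forms\<close>

definition pauli_strings :: "nat \<Rightarrow> nat list set" where
  "pauli_strings N = {\<mu>. length \<mu> = N \<and> set \<mu> \<subseteq> {0, 1, 2, 3}}"

text \<open>Spelled like the index set in \<open>sector_length\<close>, so that the two sums match
  once unfolded.\<close>

definition pauli_strings_of_weight :: "nat \<Rightarrow> nat \<Rightarrow> nat list set" where
  "pauli_strings_of_weight N m = {\<mu>. length \<mu> = N \<and> set \<mu> \<subseteq> {0, 1, 2, 3} \<and> weight \<mu> = m}"

definition bitstrings :: "nat \<Rightarrow> bool list set" where
  "bitstrings N = {x. length x = N}"

text \<open>The matrix element \<open>\<langle>v| \<sigma>\<^sub>\<mu> |u\<rangle>\<close>, for vectors whose amplitudes are indexed by bit strings.\<close>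

primrec pauli_form :: "nat list \<Rightarrow> (bool list \<Rightarrow> complex) \<Rightarrow> (bool list \<Rightarrow> complex) \<Rightarrow> complex" where
  "pauli_form [] u v = u [] * cnj (v [])"
| "pauli_form (k # \<mu>) u v =
     (\<Sum>a\<in>UNIV. \<Sum>b\<in>UNIV. pauli k $$ (of_bool b, of_bool a)
        * pauli_form \<mu> (\<lambda>x. u (a # x)) (\<lambda>x. v (b # x)))"

declare pauli_form.simps(2) [simp del]

lemma bitstrings_0: "bitstrings 0 = {[]}"
  by (auto simp: bitstrings_def)

lemma bitstrings_Suc: "bitstrings (Suc N) = (\<lambda>(a, x). a # x) ` (UNIV \<times> bitstrings N)"
  by (auto simp: bitstrings_def length_Suc_conv image_def)

lemma finite_bitstrings: "finite (bitstrings N)"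
  by (induction N) (auto simp: bitstrings_0 bitstrings_Suc)

lemma sum_bitstrings_Suc:
  "(\<Sum>x\<in>bitstrings (Suc N). f x) = (\<Sum>a\<in>UNIV. \<Sum>x\<in>bitstrings N. f (a # x))"
proof -
  have "inj_on (\<lambda>(a, x). a # x) (UNIV \<times> bitstrings N)"
    by (auto simp: inj_on_def)
  then show ?thesis
    unfolding bitstrings_Suc sum.cartesian_product
    by (subst sum.reindex) (simp_all add: split_beta)
qed

lemma pauli_strings_0: "pauli_strings 0 = {[]}"
  by (auto simp: pauli_strings_def)

lemma pauli_strings_Suc:
  "pauli_strings (Suc N) = (\<lambda>(k, \<mu>). k # \<mu>) ` ({0, 1, 2, 3} \<times> pauli_strings N)"
  by (auto simp: pauli_strings_def length_Suc_conv image_def)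

lemma finite_pauli_strings: "finite (pauli_strings N)"
  by (induction N) (auto simp: pauli_strings_0 pauli_strings_Suc)

lemma pauli_strings_of_weight_eq:
  "pauli_strings_of_weight N m = {\<mu> \<in> pauli_strings N. weight \<mu> = m}"
  by (auto simp: pauli_strings_def pauli_strings_of_weight_def)

lemma weight_simps [simp]:
  "weight [] = 0" "weight (0 # \<mu>) = weight \<mu>" "k \<noteq> 0 \<Longrightarrow> weight (k # \<mu>) = Suc (weight \<mu>)"
  by (simp_all add: weight_def)

lemma weight_le: "\<mu> \<in> pauli_strings N \<Longrightarrow> weight \<mu> \<le> N"
  by (auto simp: pauli_strings_def weight_def)

lemma sum_pauli_strings_Suc:
  "(\<Sum>\<mu>\<in>pauli_strings (Suc N). f \<mu>) = (\<Sum>\<mu>\<in>pauli_strings N. \<Sum>k\<in>{0, 1, 2, 3}. f (k # \<mu>))"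
proof -
  have "inj_on (\<lambda>(k, \<mu>). k # \<mu>) ({0, 1, 2, 3} \<times> pauli_strings N)"
    by (auto simp: inj_on_def)
  then have "(\<Sum>\<mu>\<in>pauli_strings (Suc N). f \<mu>)
      = (\<Sum>k\<in>{0, 1, 2, 3}. \<Sum>\<mu>\<in>pauli_strings N. f (k # \<mu>))"
    unfolding pauli_strings_Suc sum.cartesian_product
    by (subst sum.reindex) (simp_all add: split_beta)
  also have "\<dots> = (\<Sum>\<mu>\<in>pauli_strings N. \<Sum>k\<in>{0, 1, 2, 3}. f (k # \<mu>))"
    by (rule sum.swap)
  finally show ?thesis .
qed

lemma sum_pauli_strings_of_weight_simps:
  "(\<Sum>\<mu>\<in>pauli_strings_of_weight 0 0. f \<mu>) = f []"
  "(\<Sum>\<mu>\<in>pauli_strings_of_weight 0 (Suc m). f \<mu>) = 0"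
  "(\<Sum>\<mu>\<in>pauli_strings_of_weight (Suc N) 0. f \<mu>) = (\<Sum>\<mu>\<in>pauli_strings_of_weight N 0. f (0 # \<mu>))"
  "(\<Sum>\<mu>\<in>pauli_strings_of_weight (Suc N) (Suc m). f \<mu>) =
     (\<Sum>\<mu>\<in>pauli_strings_of_weight N (Suc m). f (0 # \<mu>))
     + (\<Sum>\<mu>\<in>pauli_strings_of_weight N m. \<Sum>k\<in>{1, 2, 3}. f (k # \<mu>))"
  by (simp_all only: pauli_strings_of_weight_eq sum.inter_filter finite_pauli_strings
      pauli_strings_0 sum_pauli_strings_Suc flip: sum.distrib)
    (auto intro!: sum.cong simp: Collect_conv_if)

lemma pauli_entries:
  "pauli 0 $$ (0, 0) = 1" "pauli 0 $$ (0, Suc 0) = 0"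
  "pauli 0 $$ (Suc 0, 0) = 0" "pauli 0 $$ (Suc 0, Suc 0) = 1"
  "pauli (Suc 0) $$ (0, 0) = 0" "pauli (Suc 0) $$ (0, Suc 0) = 1"
  "pauli (Suc 0) $$ (Suc 0, 0) = 1" "pauli (Suc 0) $$ (Suc 0, Suc 0) = 0"
  "pauli 2 $$ (0, 0) = 0" "pauli 2 $$ (0, Suc 0) = - \<i>"
  "pauli 2 $$ (Suc 0, 0) = \<i>" "pauli 2 $$ (Suc 0, Suc 0) = 0"
  "pauli 3 $$ (0, 0) = 1" "pauli 3 $$ (0, Suc 0) = 0"
  "pauli 3 $$ (Suc 0, 0) = 0" "pauli 3 $$ (Suc 0, Suc 0) = - 1"
  by (simp_all add: pauli_def mat_of_rows_list_def)

lemma pauli_form_simps: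
  "pauli_form (0 # \<mu>) u v = pauli_form \<mu> (\<lambda>x. u (False # x)) (\<lambda>x. v (False # x))
     + pauli_form \<mu> (\<lambda>x. u (True # x)) (\<lambda>x. v (True # x))"
  "pauli_form (Suc 0 # \<mu>) u v = pauli_form \<mu> (\<lambda>x. u (False # x)) (\<lambda>x. v (True # x))
     + pauli_form \<mu> (\<lambda>x. u (True # x)) (\<lambda>x. v (False # x))"
  "pauli_form (2 # \<mu>) u v = \<i> * (pauli_form \<mu> (\<lambda>x. u (False # x)) (\<lambda>x. v (True # x))
     - pauli_form \<mu> (\<lambda>x. u (True # x)) (\<lambda>x. v (False # x)))"
  "pauli_form (3 # \<mu>) u v = pauli_form \<mu> (\<lambda>x. u (False # x)) (\<lambda>x. v (False # x))
     - pauli_form \<mu> (\<lambda>x. u (True # x)) (\<lambda>x. v (True # x))"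
  by (simp_all add: pauli_form.simps(2) UNIV_bool pauli_entries algebra_simps)

lemma cnj_pauli_form: "cnj (pauli_form \<mu> u v) = pauli_form \<mu> v u"
proof (induction \<mu> arbitrary: u v)
  case Nil
  show ?case by simp
next
  case (Cons k \<mu>)
  have "cnj (pauli k $$ (of_bool b, of_bool a)) = pauli k $$ (of_bool a, of_bool b)" for a b
    by (cases a; cases b) (simp_all add: pauli_def mat_of_rows_list_def)
  then show ?case
    by (simp add: pauli_form.simps(2) Cons.IH) (rule sum.swap)
qed

lemma pauli_form_real: "complex_of_real (Re (pauli_form \<mu> u u)) = pauli_form \<mu> u u"
  using cnj_pauli_form[of \<mu> u u] by (simp add: complex_eq_iff)

lemma pauli_form_identity:
  "pauli_form (replicate N 0) u v = (\<Sum>x\<in>bitstrings N. u x * cnj (v x))"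
  by (induction N arbitrary: u v) (simp_all add: bitstrings_0 sum_bitstrings_Suc pauli_form_simps UNIV_bool)

lemma pauli_form_scale: "pauli_form \<mu> (\<lambda>x. c * u x) (\<lambda>x. d * v x) = c * cnj d * pauli_form \<mu> u v"
  by (induction \<mu> arbitrary: u v) (simp_all add: pauli_form.simps(2) sum_distrib_left mult_ac)

section \<open>The quantum MacWilliams identity\<close>

text \<open>The matrix element \<open>\<langle>v v'| (c + d F)\<^sup>\<otimes>\<^sup>N |u u'\<rangle>\<close>, where \<open>F\<close> swaps the two copies of a qubit.
  It evaluates weighted sums over Pauli strings because \<open>\<Sum>\<^sub>k \<sigma>\<^sub>k \<otimes> \<sigma>\<^sub>k = 2 F\<close>.\<close>

primrec swap_form :: "complex \<Rightarrow> complex \<Rightarrow> nat \<Rightarrow> (bool list \<Rightarrow> complex) \<Rightarrow> (bool list \<Rightarrow> complex)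
    \<Rightarrow> (bool list \<Rightarrow> complex) \<Rightarrow> (bool list \<Rightarrow> complex) \<Rightarrow> complex" where
  "swap_form c d 0 u v u' v' = u [] * cnj (v []) * (u' [] * cnj (v' []))"
| "swap_form c d (Suc N) u v u' v' = (\<Sum>a\<in>UNIV. \<Sum>b\<in>UNIV.
     c * swap_form c d N (\<lambda>x. u (a # x)) (\<lambda>x. v (a # x)) (\<lambda>x. u' (b # x)) (\<lambda>x. v' (b # x))
     + d * swap_form c d N (\<lambda>x. u (a # x)) (\<lambda>x. v (b # x)) (\<lambda>x. u' (b # x)) (\<lambda>x. v' (a # x)))"

text \<open>On one site the weights give \<alpha> 1 + \<beta> (2 F - 1) = (\<alpha> - \<beta>) 1 + 2
  \<beta> F. The four vectors stay independent because the induction splits off their first bits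
  separately.\<close>

lemma sum_pauli_form_eq_swap_form:
  "(\<Sum>\<mu>\<in>pauli_strings N. \<alpha> ^ (N - weight \<mu>) * \<beta> ^ weight \<mu> * (pauli_form \<mu> u v * pauli_form \<mu> u' v'))
     = swap_form (\<alpha> - \<beta>) (2 * \<beta>) N u v u' v'"
proof (induction N arbitrary: u v u' v')
  case 0
  show ?case by (simp add: pauli_strings_0)
next
  case (Suc N)
  define t where "t = (\<lambda>\<mu> u v u' v'.
    \<alpha> ^ (N - weight \<mu>) * \<beta> ^ weight \<mu> * (pauli_form \<mu> u v * pauli_form \<mu> u' v'))"
  have IH: "(\<Sum>\<mu>\<in>pauli_strings N. t \<mu> u v u' v') = swap_form (\<alpha> - \<beta>) (2 * \<beta>) N u v u' v'" for u v u' v'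
    unfolding t_def by (rule Suc)
  have "(\<Sum>k\<in>{0, 1, 2, 3}. \<alpha> ^ (Suc N - weight (k # \<mu>)) * \<beta> ^ weight (k # \<mu>)
          * (pauli_form (k # \<mu>) u v * pauli_form (k # \<mu>) u' v'))
      = (\<Sum>a\<in>UNIV. \<Sum>b\<in>UNIV.
          (\<alpha> - \<beta>) * t \<mu> (\<lambda>x. u (a # x)) (\<lambda>x. v (a # x)) (\<lambda>x. u' (b # x)) (\<lambda>x. v' (b # x))
          + 2 * \<beta> * t \<mu> (\<lambda>x. u (a # x)) (\<lambda>x. v (b # x)) (\<lambda>x. u' (b # x)) (\<lambda>x. v' (a # x)))"
    if "\<mu> \<in> pauli_strings N" for \<mu>
  proof -
    have ii: "\<i> * x * (\<i> * y) = - (x * y)" for x y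
      by (simp add: algebra_simps)
    \<comment> \<open>Natural subtraction truncates, so this rests on \<open>weight \<mu>\<close>
      being at most \<open>N\<close>.\<close>
    have "Suc N - weight \<mu> = Suc (N - weight \<mu>)"
      using weight_le[OF that] by simp
    then show ?thesis
      by (simp add: t_def pauli_form_simps UNIV_bool ii) (simp add: algebra_simps)
  qed
  then have "(\<Sum>\<mu>\<in>pauli_strings (Suc N). \<alpha> ^ (Suc N - weight \<mu>) * \<beta> ^ weight \<mu>
          * (pauli_form \<mu> u v * pauli_form \<mu> u' v'))
      = (\<Sum>\<mu>\<in>pauli_strings N. \<Sum>a\<in>UNIV. \<Sum>b\<in>UNIV.
          (\<alpha> - \<beta>) * t \<mu> (\<lambda>x. u (a # x)) (\<lambda>x. v (a # x)) (\<lambda>x. u' (b # x)) (\<lambda>x. v' (b # x))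
          + 2 * \<beta> * t \<mu> (\<lambda>x. u (a # x)) (\<lambda>x. v (b # x)) (\<lambda>x. u' (b # x)) (\<lambda>x. v' (a # x)))"
    unfolding sum_pauli_strings_Suc by (rule sum.cong[OF refl])
  also have "\<dots> = swap_form (\<alpha> - \<beta>) (2 * \<beta>) (Suc N) u v u' v'"
    by (simp add: UNIV_bool sum.distrib sum_distrib_left[symmetric] IH)
  finally show ?case .
qed

text \<open>Swapping all qubits exchanges \<open>v\<close> and \<open>v'\<close>, and it exchanges \<open>1\<close> and \<open>F\<close> at every site.\<close>

lemma swap_form_dual: "swap_form c d N u v u' v' = swap_form d c N u v' u' v"
proof (induction N arbitrary: u v u' v')
  case 0
  show ?case by simp
next
  case (Suc N)
  show ?case
    unfolding swap_form.simps Suc.IH UNIV_bool by simp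
qed

section \<open>Sector lengths and weight enumerators of unnormalised vectors\<close>

definition sector :: "nat \<Rightarrow> nat \<Rightarrow> (bool list \<Rightarrow> complex) \<Rightarrow> real" where
  "sector N m u = (\<Sum>\<mu>\<in>pauli_strings_of_weight N m. (Re (pauli_form \<mu> u u))\<^sup>2)"

definition weight_enumerator :: "nat \<Rightarrow> real \<Rightarrow> real \<Rightarrow> (bool list \<Rightarrow> complex) \<Rightarrow> real" where
  "weight_enumerator N \<alpha> \<beta> u = (\<Sum>m\<le>N. \<alpha> ^ (N - m) * \<beta> ^ m * sector N m u)"

lemma sector_nonneg: "0 \<le> sector N m u"
  unfolding sector_def by (intro sum_nonneg) simp

text \<open>Only the identity string has weight 0, so this is the fourth power of the norm; it
  homogenises the later relations.\<close>

lemma sector_0: "sector N 0 u = (Re (pauli_form (replicate N 0) u u))\<^sup>2"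
proof -
  have "(\<Sum>\<mu>\<in>pauli_strings_of_weight N 0. f \<mu>) = f (replicate N 0)" for f :: "nat list \<Rightarrow> real"
    by (induction N arbitrary: f) (simp_all add: sum_pauli_strings_of_weight_simps)
  then show ?thesis by (simp add: sector_def)
qed

lemma weight_enumerator_eq_swap_form:
  "complex_of_real (weight_enumerator N \<alpha> \<beta> u) = swap_form (\<alpha> - \<beta>) (2 * \<beta>) N u u u u"
proof -
  have "weight_enumerator N \<alpha> \<beta> u = (\<Sum>m\<in>{..N}. \<Sum>\<mu>\<in>{\<mu> \<in> pauli_strings N. weight \<mu> = m}.
      \<alpha> ^ (N - weight \<mu>) * \<beta> ^ weight \<mu> * (Re (pauli_form \<mu> u u))\<^sup>2)"
    unfolding weight_enumerator_def sector_def pauli_strings_of_weight_eq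
    by (intro sum.cong refl) (simp add: sum_distrib_left)
  also have "\<dots> = (\<Sum>\<mu>\<in>pauli_strings N.
      \<alpha> ^ (N - weight \<mu>) * \<beta> ^ weight \<mu> * (Re (pauli_form \<mu> u u))\<^sup>2)"
    by (rule sum.group) (auto simp: finite_pauli_strings weight_le)
  finally show ?thesis
    by (simp add: pauli_form_real power2_eq_square sum_pauli_form_eq_swap_form[symmetric])
qed

text \<open>\<open>swap_form_dual\<close> exchanges \<alpha> - \<beta> and 2 \<beta>; the new
  parameters solve \<alpha>' - \<beta>' = 2 \<beta> and 2 \<beta>' = \<alpha> - \<beta>.\<close>

lemma quantum_macwilliams:
  "weight_enumerator N \<alpha> \<beta> u = weight_enumerator N ((\<alpha> + 3 * \<beta>) / 2) ((\<alpha> - \<beta>) / 2) u"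
proof -
  have "complex_of_real (weight_enumerator N \<alpha> \<beta> u) = swap_form (2 * \<beta>) (\<alpha> - \<beta>) N u u u u"
    unfolding weight_enumerator_eq_swap_form by (rule swap_form_dual)
  also have "\<dots> = complex_of_real (weight_enumerator N ((\<alpha> + 3 * \<beta>) / 2) ((\<alpha> - \<beta>) / 2) u)"
  proof -
    have "2 * \<beta> = (\<alpha> + 3 * \<beta>) / 2 - (\<alpha> - \<beta>) / 2" "\<alpha> - \<beta> = 2 * ((\<alpha> - \<beta>) / 2)"
      by (simp_all add: field_simps)
    then show ?thesis
      unfolding weight_enumerator_eq_swap_form by (metis of_real_diff of_real_mult of_real_numeral)
  qed
  finally show ?thesis
    by (simp only: of_real_eq_iff)
qed

text \<open>At (1, 1) the sectors sum to 8 S_0; at (1, -1), sent to (-1, 1), the even and odd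
  sectors have equal sums. Hence S_0 + S_2 = 4 S_0.\<close>

lemma sector_3_2: "sector 3 2 u = 3 * sector 3 0 u"
  using quantum_macwilliams[of 3 1 1 u] quantum_macwilliams[of 3 1 "-1" u]
  by (simp add: weight_enumerator_def atMost_Suc numeral_3_eq_3 numeral_2_eq_2)

lemma sectors_5:
  "sector 5 3 u = 10 * sector 5 0 u + 2 * sector 5 1 u - sector 5 2 u"
  "sector 5 4 u = 15 * sector 5 0 u - sector 5 2 u"
  "sector 5 5 u = 6 * sector 5 0 u - 3 * sector 5 1 u + sector 5 2 u"
proof -
  have "{..5} = {0, 1, 2, 3, 4, 5 :: nat}" by auto
  note * = quantum_macwilliams[of 5 _ _ u, unfolded weight_enumerator_def this, simplified]
  \<comment> \<open>(1, 1) and (1, -1) give S_4 as for three qubits; (1, 3), sent to (5, -1),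
    separates S_3 from S_5.\<close>
  note ** = *[of 1 1] *[of 1 "-1"] *[of 3 1] *[of 1 3]
  show "sector 5 3 u = 10 * sector 5 0 u + 2 * sector 5 1 u - sector 5 2 u"
    "sector 5 4 u = 15 * sector 5 0 u - sector 5 2 u"
    "sector 5 5 u = 6 * sector 5 0 u - 3 * sector 5 1 u + sector 5 2 u"
    using ** by simp_all
qed

section \<open>The shadow inequality\<close>

text \<open>The Gram form exists because \<open>c + d F = (c + d) 1 + (- d) (1 - F)\<close> is positive.\<close>

lemma swap_form_gram:
  fixes c d :: real
  assumes "d \<le> 0" "0 \<le> c + d"
  shows "\<exists>fs. \<forall>u v u' v'. swap_form c d N u v u' v' = (\<Sum>f\<leftarrow>fs. f u u' * cnj (f v v'))"
proof (induction N)
  case 0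
  show ?case
    by (rule exI[of _ "[\<lambda>u u'. u [] * u' []]"]) simp
next
  case (Suc N)
  then obtain fs where fs:
    "\<And>u v u' v'. swap_form c d N u v u' v' = (\<Sum>f\<leftarrow>fs. f u u' * cnj (f v v'))"
    by blast
  define s t where "s = complex_of_real (sqrt (c + d))" and "t = complex_of_real (sqrt (- d))"
  have st: "s * s = c + d" "t * t = - d" "cnj s = s" "cnj t = t"
    using assms by (simp_all add: s_def t_def flip: of_real_mult of_real_add)
  \<comment> \<open>\<open>sym\<close> contracts with the four basis vectors of a site pair, which
    resolve 1; \<open>alt\<close> with |01> - |10>, whose outer product is 1 - F.\<close>
  define sym where "sym = (\<lambda>a b f (u :: bool list \<Rightarrow> complex) (u' :: bool list \<Rightarrow> complex).
    s * f (\<lambda>x. u (a # x)) (\<lambda>x. u' (b # x)) :: complex)"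
  define alt where "alt = (\<lambda>f (u :: bool list \<Rightarrow> complex) (u' :: bool list \<Rightarrow> complex).
    t * (f (\<lambda>x. u (False # x)) (\<lambda>x. u' (True # x)) - f (\<lambda>x. u (True # x)) (\<lambda>x. u' (False # x))) :: complex)"
  have "swap_form c d (Suc N) u v u' v' = (\<Sum>f\<leftarrow>map (sym False False) fs @ map (sym False True) fs
      @ map (sym True False) fs @ map (sym True True) fs @ map alt fs. f u u' * cnj (f v v'))" for u v u' v'
  proof -
    have sym: "(\<Sum>f\<leftarrow>map (sym a b) fs. f u u' * cnj (f v v')) = (c + d) * swap_form c d N
        (\<lambda>x. u (a # x)) (\<lambda>x. v (a # x)) (\<lambda>x. u' (b # x)) (\<lambda>x. v' (b # x))" for a b
    proof -
      have "(\<Sum>f\<leftarrow>map (sym a b) fs. f u u' * cnj (f v v')) = (\<Sum>f\<leftarrow>fs. (s * s) *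
          (f (\<lambda>x. u (a # x)) (\<lambda>x. u' (b # x)) * cnj (f (\<lambda>x. v (a # x)) (\<lambda>x. v' (b # x)))))"
        by (simp add: sym_def o_def st(3) mult_ac)
      then show ?thesis
        by (simp add: sum_list_const_mult fs st(1))
    qed
    define R where "R =
        swap_form c d N (\<lambda>x. u (False # x)) (\<lambda>x. v (False # x)) (\<lambda>x. u' (True # x)) (\<lambda>x. v' (True # x))
        - swap_form c d N (\<lambda>x. u (False # x)) (\<lambda>x. v (True # x)) (\<lambda>x. u' (True # x)) (\<lambda>x. v' (False # x))
        - swap_form c d N (\<lambda>x. u (True # x)) (\<lambda>x. v (False # x)) (\<lambda>x. u' (False # x)) (\<lambda>x. v' (True # x))
        + swap_form c d N (\<lambda>x. u (True # x)) (\<lambda>x. v (True # x)) (\<lambda>x. u' (False # x)) (\<lambda>x. v' (False # x))"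
    have alt: "(\<Sum>f\<leftarrow>map alt fs. f u u' * cnj (f v v')) = - d * R"
    proof -
      have "(\<Sum>f\<leftarrow>map alt fs. f u u' * cnj (f v v')) = (\<Sum>f\<leftarrow>fs. (t * t) *
          (f (\<lambda>x. u (False # x)) (\<lambda>x. u' (True # x)) * cnj (f (\<lambda>x. v (False # x)) (\<lambda>x. v' (True # x)))
          - f (\<lambda>x. u (False # x)) (\<lambda>x. u' (True # x)) * cnj (f (\<lambda>x. v (True # x)) (\<lambda>x. v' (False # x)))
          - f (\<lambda>x. u (True # x)) (\<lambda>x. u' (False # x)) * cnj (f (\<lambda>x. v (False # x)) (\<lambda>x. v' (True # x)))
          + f (\<lambda>x. u (True # x)) (\<lambda>x. u' (False # x)) * cnj (f (\<lambda>x. v (True # x)) (\<lambda>x. v' (False # x)))))"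
        by (simp add: alt_def o_def st(4) algebra_simps)
      also have "\<dots> = (t * t) * R"
        unfolding R_def fs by (simp only: sum_list_const_mult sum_list_addf sum_list_subtractf)
      finally show ?thesis
        by (simp add: st(2))
    qed
    show ?thesis
      by (simp add: sym alt R_def UNIV_bool del: map_map) (simp add: algebra_simps)
  qed
  then show ?case by blast
qed

text \<open>Here c + d = \<alpha> + \<beta> and d = 2 \<beta>, and on equal arguments the Gram form
  is a sum of squared moduli.\<close>

lemma shadow_nonneg:
  assumes "\<beta> \<le> 0" "0 \<le> \<alpha> + \<beta>"
  shows "0 \<le> weight_enumerator N \<alpha> \<beta> u"
proof -
  obtain fs where "swap_form (\<alpha> - \<beta>) (2 * \<beta>) N u u u u = (\<Sum>f\<leftarrow>fs. f u u * cnj (f u u))"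
    using swap_form_gram[of "2 * \<beta>" "\<alpha> - \<beta>" N] assms by auto
  then have "weight_enumerator N \<alpha> \<beta> u = Re (\<Sum>f\<leftarrow>fs. f u u * cnj (f u u))"
    by (metis weight_enumerator_eq_swap_form Re_complex_of_real of_real_diff of_real_mult of_real_numeral)
  also have "\<dots> = (\<Sum>f\<leftarrow>fs. (cmod (f u u))\<^sup>2)"
    by (induction fs) (simp_all add: complex_mult_cnj cmod_power2)
  also have "\<dots> \<ge> 0"
    by (rule sum_list_nonneg) auto
  finally show ?thesis .
qed

text \<open>The enumerator vanishes at \<open>(1, -1)\<close> because the number of qubits is odd, so the bound is
  nonnegativity of its derivative there: \<open>h\<close> is the difference quotient.\<close>

lemma sector_5_2_ge:
  assumes "sector 5 0 u = 1"
  shows "2 * sector 5 1 u \<le> sector 5 2 u"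
proof -
  define h where "h = (\<lambda>y. sector 5 2 u * (y + 1)\<^sup>2 - sector 5 1 u * ((y + 1) * (y\<^sup>2 + 3))
    + (y - 1)\<^sup>2 * (y\<^sup>2 + 3 * y + 6))"
  have "0 \<le> h y" if "y > 1" for y
  proof -
    have *: "{..5} = {0, 1, 2, 3, 4, 5 :: nat}" by auto
    \<comment> \<open>With r = S_1, s = S_2 and the other sectors eliminated, the enumerator at (y,
      -1) splits off y - 1.\<close>
    have id: "y ^ 5 + (y ^ 3 * s + (y * (15 - s) + (3 * r - 6 - s) - y\<^sup>2 * (10 + 2 * r - s)) - y ^ 4 * r)
        = (y - 1) * (s * (y + 1)\<^sup>2 - r * ((y + 1) * (y\<^sup>2 + 3)) + (y - 1)\<^sup>2 * (y\<^sup>2 + 3 * y + 6))"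
      for r s :: real
      by (simp add: algebra_simps eval_nat_numeral)
    have "weight_enumerator 5 y (-1) u = (y - 1) * h y"
      unfolding weight_enumerator_def * h_def
      by (simp add: sectors_5 assms id)
    then show ?thesis
      using shadow_nonneg[of "-1" y 5 u] that by (simp add: zero_le_mult_iff)
  qed
  then have "eventually (\<lambda>y. 0 \<le> h y) (at_right 1)"
    using eventually_at_right_less[of "1 :: real"] by (rule eventually_mono[rotated])
  moreover have "(h \<longlongrightarrow> h 1) (at_right 1)"
    unfolding h_def by (intro tendsto_intros)
  \<comment> \<open>h 1 = 4 S_2 - 8 S_1.\<close>
  ultimately have "0 \<le> h 1"
    by (intro tendsto_lowerbound) auto
  then show ?thesis
    by (simp add: h_def)
qed

section \<open>Bounding the second sector length by three-qubit marginals\<close>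

text \<open>\<open>xs\<close> fills the positions marked in the pattern, \<open>ys\<close> the others.\<close>

primrec interleave :: "bool list \<Rightarrow> 'a list \<Rightarrow> 'a list \<Rightarrow> 'a list" where
  "interleave [] xs ys = []"
| "interleave (b # p) xs ys =
     (if b then hd xs # interleave p (tl xs) ys else hd ys # interleave p xs (tl ys))"

definition patterns :: "nat \<Rightarrow> nat \<Rightarrow> bool list set" where
  "patterns N k = {p \<in> bitstrings N. count_list p True = k}"

lemma sum_patterns_simps:
  "(\<Sum>p\<in>patterns 0 0. f p) = f []"
  "(\<Sum>p\<in>patterns 0 (Suc k). f p) = 0"
  "(\<Sum>p\<in>patterns (Suc N) 0. f p) = (\<Sum>p\<in>patterns N 0. f (False # p))"
  "(\<Sum>p\<in>patterns (Suc N) (Suc k). f p) =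
     (\<Sum>p\<in>patterns N k. f (True # p)) + (\<Sum>p\<in>patterns N (Suc k). f (False # p))"
  by (simp_all only: patterns_def sum.inter_filter finite_bitstrings
      bitstrings_0 sum_bitstrings_Suc UNIV_bool flip: sum.distrib)
    (auto intro!: sum.cong simp: Collect_conv_if sum.distrib add.commute)

lemma sum_patterns_one: "(\<Sum>p\<in>patterns N k. 1) = real (N choose k)"
proof (induction N arbitrary: k)
  case 0
  show ?case by (cases k) (simp_all only: sum_patterns_simps, simp_all)
next
  case (Suc N)
  show ?case by (cases k) (simp_all only: sum_patterns_simps Suc.IH, simp_all)
qed

lemma patterns_empty: "N < k \<Longrightarrow> patterns N k = {}"
  by (auto simp: patterns_def bitstrings_def) (metis count_le_length not_less)

lemma pauli_strings_of_weight_empty: "N < m \<Longrightarrow> pauli_strings_of_weight N m = {}"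
  using weight_le by (fastforce simp: pauli_strings_of_weight_eq)

text \<open>Double counting: a string of weight m comes from every k-set of sites containing its
  support. The guard matters because k - m truncates to 0 when m > k.\<close>

lemma sum_interleave:
  fixes f :: "nat list \<Rightarrow> real"
  shows "(\<Sum>p\<in>patterns N k. \<Sum>\<mu>\<in>pauli_strings_of_weight k m. f (interleave p \<mu> (replicate (N - k) 0)))
    = real (if m \<le> k then (N - m) choose (k - m) else 0) * (\<Sum>\<mu>\<in>pauli_strings_of_weight N m. f \<mu>)"
proof (induction N arbitrary: k m f)
  case 0
  show ?case
    by (cases k; cases m) (simp_all add: sum_patterns_simps sum_pauli_strings_of_weight_simps)
next
  case (Suc N)
  \<comment> \<open>Patterns with the first site unmarked; if k > N there are none, and the right
    side vanishes too.\<close>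
  have drop: "(\<Sum>p\<in>patterns N k. \<Sum>\<mu>\<in>pauli_strings_of_weight k m.
        f (interleave (False # p) \<mu> (replicate (Suc N - k) 0)))
      = real (if m \<le> k then (N - m) choose (k - m) else 0) * (\<Sum>\<mu>\<in>pauli_strings_of_weight N m. f (0 # \<mu>))"
    for k m
  proof (cases "k \<le> N")
    case True
    then show ?thesis
      using Suc.IH[of "\<lambda>\<mu>. f (0 # \<mu>)"] by (simp add: Suc_diff_le)
  next
    case False
    then show ?thesis
      by (cases "m \<le> N") (simp_all add: patterns_empty pauli_strings_of_weight_empty diff_less_mono)
  qed
  show ?case
  proof (cases k)
    case 0
    then show ?thesis
      using drop[of 0 m]
      by (cases m) (simp_all add: sum_patterns_simps sum_pauli_strings_of_weight_simps)
  next
    case k: (Suc k')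
    show ?thesis
    proof (cases m)
      case 0
      then show ?thesis
        using drop[of k m] Suc.IH[of "\<lambda>\<mu>. f (0 # \<mu>)" k' 0]
        by (simp add: k sum_patterns_simps sum_pauli_strings_of_weight_simps algebra_simps)
    next
      \<comment> \<open>A string with identity first arises from patterns that mark the first site
        and from those that do not; Pascal's rule adds the counts.\<close>
      case m: (Suc m')
      have pascal: "real (if m \<le> k' then (N - m) choose (k' - m) else 0)
            * (\<Sum>\<mu>\<in>pauli_strings_of_weight N m. f (0 # \<mu>))
          + real (if m \<le> k then (N - m) choose (k - m) else 0)
            * (\<Sum>\<mu>\<in>pauli_strings_of_weight N m. f (0 # \<mu>))
          = real (if m \<le> k then (Suc N - m) choose (k - m) else 0)
            * (\<Sum>\<mu>\<in>pauli_strings_of_weight N m. f (0 # \<mu>))"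
      proof (cases "m \<le> N \<and> m \<le> k'")
        case True
        then have "Suc N - m = Suc (N - m)" "k - m = Suc (k' - m)"
          by (simp_all add: k Suc_diff_le)
        with True show ?thesis
          by (simp add: k distrib_right)
      next
        case False
        then show ?thesis
          by (cases "m = k") (auto simp: k pauli_strings_of_weight_empty)
      qed
      show ?thesis
        using drop[of k m] Suc.IH[of "\<lambda>\<mu>. f (0 # \<mu>)" k' m] pascal
          Suc.IH[of "\<lambda>\<mu>. \<Sum>j\<in>{1, 2, 3}. f (j # \<mu>)" k' m']
        unfolding k m sum_patterns_simps sum_pauli_strings_of_weight_simps
        by (simp add: sum.distrib distrib_left split: if_splits)
    qed
  qed
qed

text \<open>Identities on the unmarked sites trace them out, one unnormalised vector on the marked
  sites per basis state \<open>y\<close>.\<close>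

lemma pauli_form_interleave:
  assumes "length \<mu> = count_list p True" "n = count_list p False"
  shows "pauli_form (interleave p \<mu> (replicate n 0)) u v = (\<Sum>y\<in>bitstrings n.
    pauli_form \<mu> (\<lambda>x. u (interleave p x y)) (\<lambda>x. v (interleave p x y)))"
  using assms
proof (induction p arbitrary: \<mu> n u v)
  case Nil
  then show ?case by (simp add: bitstrings_0)
next
  case (Cons b p)
  show ?case
  proof (cases b)
    case True
    then obtain k \<mu>' where \<mu>: "\<mu> = k # \<mu>'" "length \<mu>' = count_list p True"
      using Cons.prems(1) by (auto simp: length_Suc_conv id_def)
    show ?thesis
      using Cons.prems(2) True
      by (simp add: \<mu>(1) pauli_form.simps(2) UNIV_bool Cons.IH[OF \<mu>(2)] sum.distrib sum_distrib_left)
  next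
    case False
    then obtain n' where "n = Suc n'" "n' = count_list p False"
      using Cons.prems(2) by simp
    then show ?thesis
      using Cons.prems(1) False by (simp add: pauli_form_simps UNIV_bool sum_bitstrings_Suc Cons.IH)
  qed
qed

lemma count_list_add: "count_list p True + count_list p False = length p"
  by (induction p) auto

lemma interleave_replicate:
  assumes "k = count_list p True" "n = count_list p False"
  shows "interleave p (replicate k x) (replicate n x) = replicate (length p) x"
  using assms
  by (induction p arbitrary: k n) auto

lemma L2_set_sum_le: "L2_set (\<lambda>i. \<Sum>j\<in>J. f j i) I \<le> (\<Sum>j\<in>J. L2_set (f j) I)"
proof (induction J rule: infinite_finite_induct)
  case (insert j J)
  then show ?case
    using L2_set_triangle_ineq[of "f j" "\<lambda>i. \<Sum>j\<in>J. f j i" I] by simp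
qed (simp_all add: L2_set_def)

text \<open>Tracing out the sites outside \<open>p\<close> leaves a mixture of pure states of three qubits. Each of these
  has second sector length 3 by \<open>sector_3_2\<close>, and the root of a sector length is a
  seminorm.\<close>

lemma marginal_sector_le:
  assumes p: "p \<in> patterns N 3"
  shows "(\<Sum>\<mu>\<in>pauli_strings_of_weight 3 2. (Re (pauli_form (interleave p \<mu> (replicate (N - 3) 0)) u u))\<^sup>2)
    \<le> 3 * sector N 0 u"
proof -
  define w where "w = (\<lambda>y x. u (interleave p x y))"
  define I where "I = pauli_strings_of_weight 3 2"
  have len: "3 = count_list p True" "N - 3 = count_list p False" "length p = N"
    using p count_list_add[of p]
    by (auto simp: patterns_def bitstrings_def)
  have marginal: "pauli_form (interleave p \<mu> (replicate (N - 3) 0)) u u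
      = (\<Sum>y\<in>bitstrings (N - 3). pauli_form \<mu> (w y) (w y))" if "length \<mu> = 3" for \<mu>
    unfolding w_def using that len by (intro pauli_form_interleave) simp_all
  have norm_nonneg: "0 \<le> Re (pauli_form (replicate n 0) v v)" for n v
    by (simp add: pauli_form_identity sum_nonneg complex_mult_cnj)
  have pure: "L2_set (\<lambda>\<mu>. Re (pauli_form \<mu> (w y) (w y))) I
      = sqrt 3 * Re (pauli_form (replicate 3 0) (w y) (w y))" for y
  proof -
    have "(\<Sum>\<mu>\<in>I. (Re (pauli_form \<mu> (w y) (w y)))\<^sup>2) = sector 3 2 (w y)"
      by (simp add: I_def sector_def)
    then show ?thesis
      by (simp add: L2_set_def sector_3_2 sector_0 real_sqrt_mult norm_nonneg)
  qed
  \<comment> \<open>The squared norms of the pieces add up to that of \<open>u\<close>: this is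
    \<open>marginal\<close> at the identity string.\<close>
  have total: "(\<Sum>y\<in>bitstrings (N - 3). Re (pauli_form (replicate 3 0) (w y) (w y)))
      = Re (pauli_form (replicate N 0) u u)"
    using marginal[of "replicate 3 0"] interleave_replicate[OF len(1,2), of "0 :: nat"] len(3)
    by (simp flip: Re_sum)
  have "sqrt (\<Sum>\<mu>\<in>I. (Re (pauli_form (interleave p \<mu> (replicate (N - 3) 0)) u u))\<^sup>2)
      = L2_set (\<lambda>\<mu>. \<Sum>y\<in>bitstrings (N - 3). Re (pauli_form \<mu> (w y) (w y))) I"
    unfolding L2_set_def
    by (rule arg_cong[of _ _ sqrt], rule sum.cong)
      (auto simp: marginal I_def pauli_strings_of_weight_def)
  also have "\<dots> \<le> (\<Sum>y\<in>bitstrings (N - 3). sqrt 3 * Re (pauli_form (replicate 3 0) (w y) (w y)))"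
    unfolding pure[symmetric] by (rule L2_set_sum_le)
  also have "\<dots> = sqrt (3 * sector N 0 u)"
    by (simp add: sum_distrib_left[symmetric] total sector_0 real_sqrt_mult norm_nonneg)
  finally show ?thesis
    by (simp add: I_def)
qed

text \<open>Each weight-2 string lies in N - 2 triples of sites, and 3 (N choose 3) = (N - 2) (N
  choose 2).\<close>

lemma sector_2_le:
  assumes "3 \<le> N"
  shows "sector N 2 u \<le> real (N choose 2) * sector N 0 u"
proof -
  have "real ((N - 2) choose 1) * sector N 2 u =
      (\<Sum>p\<in>patterns N 3. \<Sum>\<mu>\<in>pauli_strings_of_weight 3 2.
        (Re (pauli_form (interleave p \<mu> (replicate (N - 3) 0)) u u))\<^sup>2)"
    using sum_interleave[where k = 3 and m = 2 and N = N and f = "\<lambda>\<mu>. (Re (pauli_form \<mu> u u))\<^sup>2"] assms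
    by (simp add: sector_def)
  also have "\<dots> \<le> (\<Sum>p\<in>patterns N 3. 3 * sector N 0 u)"
    by (intro sum_mono marginal_sector_le)
  also have "\<dots> = 3 * real (N choose 3) * sector N 0 u"
    using sum_patterns_one[of N 3] by (simp add: sum_distrib_right[symmetric])
  also have "3 * (N choose 3) = (N - 2) * (N choose 2)"
    using binomial_absorption[of 2 N] binomial_absorb_comp[of N 2] by (simp add: numeral_3_eq_3)
  then have "3 * real (N choose 3) = real (N - 2) * real (N choose 2)"
    by (metis of_nat_mult of_nat_numeral)
  finally show ?thesis
    using assms by simp
qed

section \<open>From amplitudes to density matrices\<close>

text \<open>The first qubit is the most significant bit, matching \<^const>\<open>kronecker\<close>.\<close>

primrec index_of :: "bool list \<Rightarrow> nat" where
  "index_of [] = 0"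
| "index_of (b # x) = of_bool b * 2 ^ length x + index_of x"

lemma index_of_less: "index_of x < 2 ^ length x"
  by (induction x) auto

lemma bij_betw_index_of: "bij_betw index_of (bitstrings N) {..<2 ^ N}"
proof -
  have "inj_on index_of (bitstrings N)"
  proof (induction N)
    case (Suc N)
    have "a = b \<and> x = y"
      if "x \<in> bitstrings N" "y \<in> bitstrings N" "index_of (a # x) = index_of (b # y)" for a b x y
    proof -
      have "length x = N" "length y = N"
        using that by (simp_all add: bitstrings_def)
      then have "a = b"
        using that(3) index_of_less[of x] index_of_less[of y] by (cases a; cases b) simp_all
      then have "index_of x = index_of y"
        using that(3) \<open>length x = N\<close> \<open>length y = N\<close> by simp
      then have "x = y"
        using inj_onD[OF Suc.IH] that(1,2) by blast
      with \<open>a = b\<close> show ?thesis ..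
    qed
    then show ?case
      by (intro inj_onI) (auto simp: bitstrings_Suc simp del: index_of.simps)
  qed (simp add: bitstrings_0)
  moreover have "card (bitstrings N) = 2 ^ N"
    using card_lists_length_eq[of "UNIV :: bool set" N] by (simp add: bitstrings_def)
  moreover have "index_of ` bitstrings N \<subseteq> {..<2 ^ N}"
    using index_of_less by (auto simp: bitstrings_def)
  ultimately show ?thesis
    by (simp add: bij_betw_def card_image card_subset_eq)
qed

lemma sum_index_of: "(\<Sum>i<2 ^ N. f i) = (\<Sum>x\<in>bitstrings N. f (index_of x))"
  by (rule sum.reindex_bij_betw[OF bij_betw_index_of, symmetric])

lemma dim_pauli: "dim_row (pauli k) = 2" "dim_col (pauli k) = 2"
  by (simp_all add: pauli_def mat_of_rows_list_def)

lemma pauli_string_Cons_entry: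
  assumes "length x = length \<mu>" "length y = length \<mu>"
  shows "pauli_string (k # \<mu>) $$ (index_of (b # y), index_of (a # x))
    = pauli k $$ (of_bool b, of_bool a) * pauli_string \<mu> $$ (index_of y, index_of x)"
proof -
  have "index_of x < 2 ^ length \<mu>" "index_of y < 2 ^ length \<mu>"
    using index_of_less[of x] index_of_less[of y] assms by simp_all
  then show ?thesis
    using assms by (auto simp: kronecker_def dim_pauli dim_pauli_string)
qed

lemma pauli_form_eq_sum:
  "pauli_form \<mu> u v = (\<Sum>x\<in>bitstrings (length \<mu>). \<Sum>y\<in>bitstrings (length \<mu>).
     pauli_string \<mu> $$ (index_of y, index_of x) * (u x * cnj (v y)))"
proof (induction \<mu> arbitrary: u v)
  case Nil
  show ?case by (simp add: bitstrings_0)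
next
  case (Cons k \<mu>)
  have "(\<Sum>x\<in>bitstrings (Suc (length \<mu>)). \<Sum>y\<in>bitstrings (Suc (length \<mu>)).
       pauli_string (k # \<mu>) $$ (index_of y, index_of x) * (u x * cnj (v y)))
    = (\<Sum>a\<in>UNIV. \<Sum>x\<in>bitstrings (length \<mu>). \<Sum>b\<in>UNIV. \<Sum>y\<in>bitstrings (length \<mu>).
       pauli k $$ (of_bool b, of_bool a) * (pauli_string \<mu> $$ (index_of y, index_of x)
         * (u (a # x) * cnj (v (b # y)))))"
    unfolding sum_bitstrings_Suc mult.assoc[symmetric]
    by (intro sum.cong refl)
      (simp add: bitstrings_def pauli_string_Cons_entry del: pauli_string.simps index_of.simps)
  also have "\<dots> = pauli_form (k # \<mu>) u v"
    unfolding pauli_form.simps(2) Cons.IH sum_distrib_left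
    by (intro sum.cong refl sum.swap)
  finally show ?case by simp
qed

lemma trace_projector_pauli_string:
  assumes "\<psi> \<in> carrier_vec (2 ^ N)" "length \<mu> = N"
  shows "mat_trace (projector \<psi> * pauli_string \<mu>)
    = pauli_form \<mu> (\<lambda>x. \<psi> $ index_of x) (\<lambda>x. \<psi> $ index_of x)"
proof -
  have "mat_trace (projector \<psi> * pauli_string \<mu>)
      = (\<Sum>i<2 ^ N. \<Sum>j<2 ^ N. pauli_string \<mu> $$ (j, i) * (\<psi> $ i * cnj (\<psi> $ j)))"
    using assms by (simp add: mat_trace_def projector_def scalar_prod_def dim_pauli_string
        atLeast0LessThan mult.commute)
  then show ?thesis
    using assms(2) by (simp only: sum_index_of pauli_form_eq_sum)
qed

lemma sector_length_projector:
  assumes "\<psi> \<in> carrier_vec (2 ^ N)"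
  shows "sector_length N m (projector \<psi>) = sector N m (\<lambda>x. \<psi> $ index_of x)"
  unfolding sector_length_def sector_def pauli_strings_of_weight_def
  by (intro sum.cong refl) (simp add: trace_projector_pauli_string[OF assms])

lemma cscalar_prod_self:
  assumes "\<psi> \<in> carrier_vec (2 ^ N)"
  shows "\<psi> \<bullet>c \<psi> = pauli_form (replicate N 0) (\<lambda>x. \<psi> $ index_of x) (\<lambda>x. \<psi> $ index_of x)"
  using assms
  by (simp only: scalar_prod_def pauli_form_identity atLeast0LessThan dim_vec_conjugate carrier_vecD sum_index_of)
    (intro sum.cong refl, use index_of_less in \<open>force simp: bitstrings_def\<close>)

text \<open>Sector lengths are quartic in the amplitudes, so dividing by sqrt n divides them by n
  squared; witnesses may stay unnormalised.\<close>

lemma exists_state: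
  assumes "pauli_form (replicate N 0) u u = complex_of_real n" "n > 0"
  shows "\<exists>\<psi>. pure_state N \<psi> \<and> (\<forall>m. sector_length N m (projector \<psi>) = sector N m u / n\<^sup>2)"
proof -
  define c where "c = complex_of_real (1 / sqrt n)"
  have c: "c * cnj c = complex_of_real (1 / n)"
    using assms(2) by (simp add: c_def flip: of_real_mult)
  define \<psi> where "\<psi> = vec (2 ^ N) (\<lambda>i. c * u (the_inv_into (bitstrings N) index_of i))"
  have \<psi>: "\<psi> \<in> carrier_vec (2 ^ N)"
    by (simp add: \<psi>_def)
  have "\<psi> $ index_of x = c * u x" if "x \<in> bitstrings N" for x
    using that bij_betw_index_of[of N] index_of_less[of x]
    by (simp add: \<psi>_def bitstrings_def bij_betw_def the_inv_into_f_f)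
  then have "pauli_form \<mu> (\<lambda>x. \<psi> $ index_of x) (\<lambda>x. \<psi> $ index_of x)
      = pauli_form \<mu> (\<lambda>x. c * u x) (\<lambda>x. c * u x)"
    if "length \<mu> = N" for \<mu>
    unfolding pauli_form_eq_sum that by (intro sum.cong refl) simp
  then have eq: "pauli_form \<mu> (\<lambda>x. \<psi> $ index_of x) (\<lambda>x. \<psi> $ index_of x)
      = of_real (1 / n) * pauli_form \<mu> u u" if "length \<mu> = N" for \<mu>
    using that by (simp only: pauli_form_scale c)
  have "sector N m (\<lambda>x. \<psi> $ index_of x) = sector N m u / n\<^sup>2" for m
    unfolding sector_def sum_divide_distrib
    by (intro sum.cong refl) (simp add: eq pauli_strings_of_weight_def Re_divide_of_real power_divide)
  moreover have "\<psi> \<bullet>c \<psi> = 1"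
    using assms by (simp add: cscalar_prod_self[OF \<psi>] eq)
  ultimately show ?thesis
    using \<psi> unfolding pure_state_def
    by (intro exI[of _ \<psi>]) (simp add: sector_length_projector)
qed

lemma sum_weight_5:
  fixes f :: "nat list \<Rightarrow> real"
  shows "(\<Sum>\<mu>\<in>pauli_strings_of_weight 5 1. f \<mu>) = (\<Sum>k\<in>{1, 2, 3}.
      f [k, 0, 0, 0, 0] + f [0, k, 0, 0, 0] + f [0, 0, k, 0, 0] + f [0, 0, 0, k, 0] + f [0, 0, 0, 0, k])"
    "(\<Sum>\<mu>\<in>pauli_strings_of_weight 5 2. f \<mu>) = (\<Sum>k\<in>{1, 2, 3}. \<Sum>l\<in>{1, 2, 3}.
      f [k, l, 0, 0, 0] + f [k, 0, l, 0, 0] + f [k, 0, 0, l, 0] + f [k, 0, 0, 0, l] + f [0, k, l, 0, 0]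
      + f [0, k, 0, l, 0] + f [0, k, 0, 0, l] + f [0, 0, k, l, 0] + f [0, 0, k, 0, l] + f [0, 0, 0, k, l])"
proof -
  have *: "5 = Suc (Suc (Suc (Suc (Suc 0))))" "1 = Suc 0" "2 = Suc (Suc 0)"
    by simp_all
  show "(\<Sum>\<mu>\<in>pauli_strings_of_weight 5 1. f \<mu>) = (\<Sum>k\<in>{1, 2, 3}.
      f [k, 0, 0, 0, 0] + f [0, k, 0, 0, 0] + f [0, 0, k, 0, 0] + f [0, 0, 0, k, 0] + f [0, 0, 0, 0, k])"
    unfolding * sum_pauli_strings_of_weight_simps by (simp add: sum.distrib)
  show "(\<Sum>\<mu>\<in>pauli_strings_of_weight 5 2. f \<mu>) = (\<Sum>k\<in>{1, 2, 3}. \<Sum>l\<in>{1, 2, 3}.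
      f [k, l, 0, 0, 0] + f [k, 0, l, 0, 0] + f [k, 0, 0, l, 0] + f [k, 0, 0, 0, l] + f [0, k, l, 0, 0]
      + f [0, k, 0, l, 0] + f [0, k, 0, 0, l] + f [0, 0, k, l, 0] + f [0, 0, k, 0, l] + f [0, 0, 0, k, l])"
    unfolding * sum_pauli_strings_of_weight_simps by (simp add: sum.distrib)
qed

section \<open>States on the boundary of the triangle\<close>

definition ghz_state :: "complex \<Rightarrow> complex \<Rightarrow> bool list \<Rightarrow> complex" where
  "ghz_state a b x = (if True \<notin> set x then a else if False \<notin> set x then b else 0)"

text \<open>Even-weight strings, read cyclically. The amplitudes \<open>(1, -1, 1, -1)\<close> give a codeword of the
  perfect five-qubit code, and \<open>(1, 1, 1, 1)\<close> gives a GHZ state in the \<open>\<sigma>\<^sub>1\<close> eigenbasis.\<close>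

definition ring_state :: "complex \<Rightarrow> complex \<Rightarrow> complex \<Rightarrow> complex \<Rightarrow> bool list \<Rightarrow> complex" where
  "ring_state a p q r x = (let w = count_list x True in
     if w = 0 then a else if w = 4 then r else if w \<noteq> 2 then 0
     else if x ! 0 \<and> x ! 1 \<or> x ! 1 \<and> x ! 2 \<or> x ! 2 \<and> x ! 3 \<or> x ! 3 \<and> x ! 4 \<or> x ! 4 \<and> x ! 0
       then p else q)"

lemma replicate_5: "replicate 5 x = [x, x, x, x, x]"
  by (simp add: numeral_eq_Suc)

lemma ghz_state_norm: "pauli_form (replicate 5 0) (ghz_state a b) (ghz_state a b) = a * cnj a + b * cnj b"
  by (simp add: replicate_5 pauli_form_simps ghz_state_def)

text \<open>Only sigma_3 on single sites and sigma_3 sigma_3 on pairs have nonzero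
  expectation.\<close>

lemma ghz_state_sectors:
  "sector 5 1 (ghz_state (of_real a) (of_real b)) = 5 * (a\<^sup>2 - b\<^sup>2)\<^sup>2"
  "sector 5 2 (ghz_state (of_real a) (of_real b)) = 10 * (a\<^sup>2 + b\<^sup>2)\<^sup>2"
  unfolding sector_def sum_weight_5
  by (simp_all add: pauli_form_simps ghz_state_def power2_eq_square)

lemma ring_state_norm:
  "pauli_form (replicate 5 0) (ring_state a p q r) (ring_state a p q r)
     = a * cnj a + 5 * (p * cnj p + q * cnj q + r * cnj r)"
  by (simp add: replicate_5 pauli_form_simps ring_state_def)

text \<open>sigma_1 and sigma_2 flip the parity, so only sigma_3 survives, with the same value at
  all five sites.\<close>

lemma ring_state_sector_1:
  "sector 5 1 (ring_state a p q r) = 5 * ((cmod a)\<^sup>2 + (cmod p)\<^sup>2 + (cmod q)\<^sup>2 - 3 * (cmod r)\<^sup>2)\<^sup>2"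
  unfolding sector_def sum_weight_5
  by (simp add: pauli_form_simps ring_state_def cmod_power2 flip: power2_eq_square)
    (simp add: algebra_simps)

text \<open>The squares belong to sigma_k sigma_k, k = 1, 2, 3, first on adjacent and then on
  nonadjacent pairs. Mixed words vanish by parity or by realness.\<close>

lemma ring_state_sector_2_real:
  fixes a p q r :: real
  shows "sector 5 2 (ring_state (of_real a) (of_real p) (of_real q) (of_real r)) = 5 *
    ((2 * a * p + 4 * p * q + 2 * q * r + 4 * p * r + 2 * q\<^sup>2 + 2 * r\<^sup>2)\<^sup>2
    + (4 * p * q + 2 * q\<^sup>2 + 2 * r\<^sup>2 - 2 * a * p - 2 * q * r - 4 * p * r)\<^sup>2
    + (a\<^sup>2 + p\<^sup>2 + r\<^sup>2 - 3 * q\<^sup>2)\<^sup>2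
    + (2 * a * q + 4 * p * q + 2 * p * r + 4 * q * r + 2 * p\<^sup>2 + 2 * r\<^sup>2)\<^sup>2
    + (4 * p * q + 2 * p\<^sup>2 + 2 * r\<^sup>2 - 2 * a * q - 2 * p * r - 4 * q * r)\<^sup>2
    + (a\<^sup>2 + q\<^sup>2 + r\<^sup>2 - 3 * p\<^sup>2)\<^sup>2)"
  unfolding sector_def sum_weight_5
  by (simp add: pauli_form_simps ring_state_def flip: power2_eq_square) (simp add: algebra_simps)

lemma ring_state_sector_2_phase:
  assumes "cmod w = 1"
  shows "sector 5 2 (ring_state 1 w 1 w) = 320 * ((1 + Re w) * (3 + Re w))"
proof -
  have w: "w * cnj w = 1"
    using complex_norm_square[of w] assms by simp
  \<comment> \<open>Each of the ten pairs has 8 + 8 Re w from sigma_1 sigma_1 and 4 Im w from both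
    sigma_1 sigma_2 and sigma_2 sigma_1.\<close>
  have "sector 5 2 (ring_state 1 w 1 w) = 10 * (8 + 8 * Re w)\<^sup>2 + 20 * (4 * Im w)\<^sup>2"
    unfolding sector_def sum_weight_5
    by (simp add: pauli_form_simps ring_state_def w) (simp add: algebra_simps)
  also have "(4 * Im w)\<^sup>2 = 16 * (1 - (Re w)\<^sup>2)"
    using assms cmod_power2[of w] by (simp add: power_mult_distrib)
  finally show ?thesis
    by (simp add: power2_eq_square algebra_simps)
qed

section \<open>Necessary conditions, the three edges and the frontier\<close>

lemma pure_state_sectors:
  assumes "pure_state 5 \<psi>" and S: "\<And>m. S m = sector_length 5 m (projector \<psi>)"
  shows "0 \<le> S 1" "2 * S 1 \<le> S 2" "S 2 \<le> 10"
    "S 3 = 10 + 2 * S 1 - S 2" "S 4 = 15 - S 2" "S 5 = 6 - 3 * S 1 + S 2"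
proof -
  define u where "u = (\<lambda>x. \<psi> $ index_of x)"
  have \<psi>: "\<psi> \<in> carrier_vec (2 ^ 5)" "\<psi> \<bullet>c \<psi> = 1"
    using assms(1) by (simp_all add: pure_state_def)
  have S_eq: "S m = sector 5 m u" for m
    unfolding S u_def by (rule sector_length_projector[OF \<psi>(1)])
  have "sector 5 0 u = 1"
    using \<psi>(2) by (simp add: sector_0 cscalar_prod_self[OF \<psi>(1)] u_def)
  then show "0 \<le> S 1" "2 * S 1 \<le> S 2" "S 2 \<le> 10"
    "S 3 = 10 + 2 * S 1 - S 2" "S 4 = 15 - S 2" "S 5 = 6 - 3 * S 1 + S 2"
    using sector_5_2_ge[of u] sector_2_le[of 5 u] sectors_5[of u]
    by (simp_all add: S_eq sector_nonneg choose_two)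
qed

lemma exists_state_upper_edge:
  assumes "0 \<le> s" "s \<le> 5"
  shows "\<exists>\<psi>. pure_state 5 \<psi> \<and> sector_length 5 1 (projector \<psi>) = s
    \<and> sector_length 5 2 (projector \<psi>) = 10"
proof -
  \<comment> \<open>\<open>d\<close> is to be a^2 - b^2, since S_1 = 5 (a^2 - b^2)^2.\<close>
  define d where "d = sqrt (s / 5)"
  have d: "0 \<le> d" "d \<le> 1" "d\<^sup>2 = s / 5"
    using assms by (simp_all add: d_def)
  define a b where "a = sqrt ((1 + d) / 2)" and "b = sqrt ((1 - d) / 2)"
  have ab: "a\<^sup>2 = (1 + d) / 2" "b\<^sup>2 = (1 - d) / 2"
    using d by (simp_all add: a_def b_def)
  define u where "u = ghz_state (of_real a) (of_real b)"
  have "pauli_form (replicate 5 0) u u = complex_of_real (a\<^sup>2 + b\<^sup>2)"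
    by (simp add: u_def ghz_state_norm power2_eq_square)
  then have "pauli_form (replicate 5 0) u u = complex_of_real 1"
    by (simp add: ab add_divide_distrib[symmetric])
  then obtain \<psi> where \<psi>: "pure_state 5 \<psi>" "\<And>m. sector_length 5 m (projector \<psi>) = sector 5 m u / 1\<^sup>2"
    using exists_state[of 5 u 1] by auto
  have "a\<^sup>2 - b\<^sup>2 = d" "a\<^sup>2 + b\<^sup>2 = 1"
    by (simp_all add: ab field_simps)
  then have "sector 5 1 u = s" "sector 5 2 u = 10"
    by (simp_all only: u_def ghz_state_sectors) (simp_all add: d(3))
  with \<psi> show ?thesis by auto
qed

lemma exists_state_left_edge:
  assumes "0 \<le> s" "s \<le> 10"
  shows "\<exists>\<psi>. pure_state 5 \<psi> \<and> sector_length 5 1 (projector \<psi>) = 0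
    \<and> sector_length 5 2 (projector \<psi>) = s"
proof -
  \<comment> \<open>With squared norm 16, S_2 = 320 (1 + c) (3 + c) / 256 for c = Re w; this is the
    root of S_2 = s lying in [-1, 1].\<close>
  define c where "c = sqrt (1 + 4 / 5 * s) - 2"
  have "1 \<le> sqrt (1 + 4 / 5 * s)" "sqrt (1 + 4 / 5 * s) \<le> 3"
    using assms by (simp_all add: real_le_lsqrt)
  then have "\<bar>c\<bar> \<le> 1"
    unfolding c_def by linarith
  then have c: "c\<^sup>2 \<le> 1"
    by (simp add: abs_square_le_1)
  have "(c + 2)\<^sup>2 = 1 + 4 / 5 * s"
    using assms by (simp add: c_def)
  then have s: "(1 + c) * (3 + c) = 4 / 5 * s"
    by (simp add: power2_eq_square algebra_simps)
  define w where "w = Complex c (sqrt (1 - c\<^sup>2))"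
  have w: "cmod w = 1" "Re w = c"
    using c by (simp_all add: w_def cmod_def)
  define u where "u = ring_state 1 w 1 w"
  have "pauli_form (replicate 5 0) u u = complex_of_real 16"
    using complex_norm_square[of w] w(1) by (simp add: u_def ring_state_norm)
  then obtain \<psi> where \<psi>: "pure_state 5 \<psi>" "\<And>m. sector_length 5 m (projector \<psi>) = sector 5 m u / 16\<^sup>2"
    using exists_state[of 5 u 16] by auto
  have "sector 5 1 u = 0" "sector 5 2 u = 256 * s"
    by (simp_all only: u_def ring_state_sector_1 ring_state_sector_2_phase[OF w(1)])
      (simp_all add: w s)
  with \<psi> have "sector_length 5 1 (projector \<psi>) = 0" "sector_length 5 2 (projector \<psi>) = s"
    by (simp_all only: \<psi>(2)) simp_all
  with \<psi>(1) show ?thesis by blast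
qed

lemma exists_state_lower_edge:
  assumes "0 \<le> s" "s \<le> 5"
  shows "\<exists>\<psi>. pure_state 5 \<psi> \<and> sector_length 5 1 (projector \<psi>) = s
    \<and> sector_length 5 2 (projector \<psi>) = 2 * s"
proof -
  \<comment> \<open>For amplitudes (1, -t, t, -t^2), \<open>n\<close> is the squared norm and
    \<open>z\<close> the unnormalised sigma_3 expectation at a site.\<close>
  define n z where "n = (\<lambda>t :: real. 1 + 10 * t\<^sup>2 + 5 * t ^ 4)"
    and "z = (\<lambda>t :: real. 1 + 2 * t\<^sup>2 - 3 * t ^ 4)"
  have n: "n t > 0" for t
    unfolding n_def by (simp add: add_pos_nonneg)
  have "\<exists>t\<ge>0. t \<le> 1 \<and> 5 * (z t)\<^sup>2 / (n t)\<^sup>2 = s"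
  \<comment> \<open>S_1 falls from 5 at the product state t = 0 to 0 at the code state t =
    1.\<close>
  proof (rule IVT2')
    show "5 * (z 1)\<^sup>2 / (n 1)\<^sup>2 \<le> s" "s \<le> 5 * (z 0)\<^sup>2 / (n 0)\<^sup>2"
      using assms by (simp_all add: n_def z_def)
    have "continuous_on {0..1} n" "continuous_on {0..1} z"
      unfolding n_def z_def by (intro continuous_intros)+
    then show "continuous_on {0..1} (\<lambda>t. 5 * (z t)\<^sup>2 / (n t)\<^sup>2)"
      using n by (intro continuous_intros) (auto simp: less_imp_neq[symmetric])
  qed simp
  then obtain t where t: "5 * (z t)\<^sup>2 / (n t)\<^sup>2 = s"
    by blast
  define u where "u = ring_state (of_real 1) (of_real (- t)) (of_real t) (of_real (- t\<^sup>2))"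
  have "pauli_form (replicate 5 0) u u = complex_of_real (n t)"
    by (simp add: u_def ring_state_norm n_def power2_eq_square power4_eq_xxxx mult.assoc)
  then obtain \<psi> where \<psi>: "pure_state 5 \<psi>" "\<And>m. sector_length 5 m (projector \<psi>) = sector 5 m u / (n t)\<^sup>2"
    using exists_state[of 5 u "n t"] n[of t] by auto
  have "sector 5 1 u = 5 * (z t)\<^sup>2"
    unfolding u_def ring_state_sector_1 z_def
    by (simp add: norm_power power_mult[symmetric] algebra_simps)
  moreover have "sector 5 2 u = 10 * (z t)\<^sup>2"
    unfolding u_def ring_state_sector_2_real z_def
    by (simp add: algebra_simps power2_eq_square power4_eq_xxxx)
  ultimately show ?thesis
    using \<psi> t by (auto intro!: exI[of _ \<psi>])
qed

lemma frontier_triangle: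
  fixes T :: "(real \<times> real) set"
  assumes T: "T = {(s1, s2). 0 \<le> s1 \<and> s1 \<le> 5 \<and> 2 * s1 \<le> s2 \<and> s2 \<le> 10}"
    and s: "(s1, s2) \<in> frontier T"
  shows "0 \<le> s1" "s1 \<le> 5" "2 * s1 \<le> s2" "s2 \<le> 10" "s1 = 0 \<or> s2 = 10 \<or> s2 = 2 * s1"
proof -
  have T': "T = {x. 0 \<le> fst x \<and> fst x \<le> 5 \<and> 2 * fst x \<le> snd x \<and> snd x \<le> 10}"
    unfolding T by auto
  have "closed T"
    unfolding T' by (intro closed_Collect_conj closed_Collect_le continuous_intros)
  then have "(s1, s2) \<in> T"
    using s frontier_subset_closed by blast
  then show *: "0 \<le> s1" "s1 \<le> 5" "2 * s1 \<le> s2" "s2 \<le> 10"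
    by (simp_all add: T')
  \<comment> \<open>These strict inequalities also force s_1 < 5, so \<open>U\<close> is an open
    part of \<open>T\<close>.\<close>
  define U :: "(real \<times> real) set" where "U = {x. 0 < fst x \<and> 2 * fst x < snd x \<and> snd x < 10}"
  have "open U"
    unfolding U_def by (intro open_Collect_conj open_Collect_less continuous_intros)
  moreover have "U \<subseteq> T"
    by (auto simp: U_def T')
  ultimately have "U \<subseteq> interior T"
    by (rule interior_maximal[rotated])
  then have "(s1, s2) \<notin> U"
    using s by (auto simp: frontier_def)
  then show "s1 = 0 \<or> s2 = 10 \<or> s2 = 2 * s1"
    using * by (auto simp: U_def)
qed

theorem mainTheorem3:
  fixes T :: "(real \<times> real) set"
    and S :: "nat \<Rightarrow> complex vec \<Rightarrow> real"
  assumes T: "T = {(s1, s2). 0 \<le> s1 \<and> s1 \<le> 5 \<and> 2 * s1 \<le> s2 \<and> s2 \<le> 10}"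
    and S: "\<And>m \<psi>. S m \<psi> = sector_length 5 m (projector \<psi>)"
  shows "(\<forall>\<psi>. pure_state 5 \<psi> \<longrightarrow>
            (S 1 \<psi>, S 2 \<psi>) \<in> T
            \<and> S 3 \<psi> = 10 + 2 * S 1 \<psi> - S 2 \<psi>
            \<and> S 4 \<psi> = 15 - S 2 \<psi>
            \<and> S 5 \<psi> = 6 - 3 * S 1 \<psi> + S 2 \<psi>)
       \<and> (\<forall>(s1, s2) \<in> frontier T. \<exists>\<psi>. pure_state 5 \<psi> \<and> (S 1 \<psi>, S 2 \<psi>) = (s1, s2))"
proof (intro conjI allI impI ballI)
  fix \<psi>
  assume "pure_state 5 \<psi>"
  note sectors = pure_state_sectors[OF this, of "\<lambda>m. S m \<psi>", OF S]
  show "(S 1 \<psi>, S 2 \<psi>) \<in> T"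
    using sectors(1-3) by (simp add: T)
  show "S 3 \<psi> = 10 + 2 * S 1 \<psi> - S 2 \<psi>" "S 4 \<psi> = 15 - S 2 \<psi>"
    "S 5 \<psi> = 6 - 3 * S 1 \<psi> + S 2 \<psi>"
    by (rule sectors)+
next
  fix x
  assume x: "x \<in> frontier T"
  obtain s1 s2 where x_eq: "x = (s1, s2)"
    by (cases x)
  note edge = frontier_triangle[OF T x[unfolded x_eq]]
  from edge(5) have "\<exists>\<psi>. pure_state 5 \<psi> \<and> S 1 \<psi> = s1 \<and> S 2 \<psi> = s2"
  proof (elim disjE)
    assume "s1 = 0"
    then show ?thesis
      using exists_state_left_edge[of s2] edge by (simp add: S)
  next
    assume "s2 = 10"
    then show ?thesis
      using exists_state_upper_edge[of s1] edge by (simp add: S)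
  next
    assume "s2 = 2 * s1"
    then show ?thesis
      using exists_state_lower_edge[of s1] edge by (simp add: S)
  qed
  then show "case x of (s1, s2) \<Rightarrow> \<exists>\<psi>. pure_state 5 \<psi> \<and> (S 1 \<psi>, S 2 \<psi>) = (s1, s2)"
    by (simp add: x_eq)
qed

end
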